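(* Let $p$ be an odd prime and let $q_p(2)=\frac{2^{p-1}-1}{p}$. Let $M_{p-2}$ be the number of permutations of $p-2$ letters that have an even number of ascents and are distinct from the identity. Then $$q_p(2)\equiv 2M_{p-2}+1\pmod p.$$
   Context: For a permutation $(i_1,\dots,i_n)$ of $\{1,\dots,n\}$ (mapping $j$ to $i_j$), an ascent is an index $k$ with $i_{k+1}>i_k$. *)

theory Defs
  imports "HOL-Combinatorics.Permutations" "HOL-Number_Theory.Number_Theory"
begin

definition ascents :: "nat \<Rightarrow> (nat \<Rightarrow> nat) \<Rightarrow> nat set" where
  "ascents n \<pi> = {k \<in> {1..<n}. \<pi> (k + 1) > \<pi> k}"

definition even_ascent_count :: "nat \<Rightarrow> nat" where
  "even_ascent_count n = card {\<pi>. \<pi> permutes {1..n} \<and> even (card (ascents n \<pi>)) \<and> \<pi> \<noteq> id}"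

(* The quotient is exact when p is a prime not dividing a, by Fermat's little theorem; see the lemma below. *)
definition fermat_quotient :: "nat \<Rightarrow> nat \<Rightarrow> nat" where
  "fermat_quotient p a = (a ^ (p - 1) - 1) div p"

lemma fermat_quotient_exact:
  assumes "prime p" "\<not> p dvd a"
  shows "p * fermat_quotient p a = a ^ (p - 1) - 1"
proof -
  have "[a ^ (p - 1) = 1] (mod p)"
    using assms by (rule fermat_theorem)
  moreover have "a ^ (p - 1) \<ge> 1"
    using assms by (cases "a = 0") auto
  ultimately have "p dvd a ^ (p - 1) - 1"
    by (simp add: cong_altdef_nat)
  then show ?thesis
    by (simp add: fermat_quotient_def)
qed

end

theory Submission
  imports Defs "HOL-Combinatorics.Multiset_Permutations" "HOL-Computational_Algebra.Formal_Power_Series"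
begin

text \<open>
  Let $a_n$ be the sum of $(-1)^{\mathrm{asc}\,\pi}$ over the permutations of $n$ letters. Splitting a
  permutation, written as a word, at its largest letter shows that the exponential generating
  function $F$ of $a_n$ satisfies $F' = 2F - F^2$, so $F = 2/(1 + e^{-2t})$. For odd $p$ this gives
  $F\,(1 + e^{-2pt}) = 2 \sum_{j<p} (-1)^j e^{-2jt}$, and modulo $p$ the factor $e^{-2pt}$ acts as $1$;
  hence $a_n \equiv \sum_{j<p} (-1)^j (-2j)^n$. For $n = p - 2$ the right-hand side is congruent to
  $2^{p-2} \sum_{0<m<p} (-1)^{m-1} m^{p-2}$ and so to $q_p(2)$, because
  $2 q_p(2) = \sum_{0<m<p} \frac{1}{p}\binom{p}{m} \equiv \sum_{0<m<p} (-1)^{m-1} m^{p-2}$.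
  Finally the identity has $p - 3$ ascents, an even number, so $2(M_{p-2} + 1) = (p-2)! + a_{p-2}$,
  where $(p-2)! \equiv 1$ by Wilson's theorem.
\<close>

section \<open>Ascents of words and the signed ascent count\<close>

fun list_ascents :: "nat list \<Rightarrow> nat" where
  "list_ascents (x # y # xs) = of_bool (x < y) + list_ascents (y # xs)"
| "list_ascents xs = 0"

lemma list_ascents_append:
  "list_ascents (xs @ ys) = list_ascents xs + list_ascents ys +
     of_bool (xs \<noteq> [] \<and> ys \<noteq> [] \<and> last xs < hd ys)"
proof (induction xs rule: list_ascents.induct)
  case ("2_2" x)
  then show ?case by (cases ys) auto
qed auto

lemma list_ascents_map:
  "list_ascents (map \<pi> [1..<Suc n]) = card (ascents n \<pi>)"
proof (induction n)
  case 0
  then show ?case by (simp add: ascents_def)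
next
  case (Suc n)
  have "ascents (Suc n) \<pi> =
      ascents n \<pi> \<union> (if n > 0 \<and> \<pi> n < \<pi> (Suc n) then {n} else {})"
    by (auto simp: ascents_def less_Suc_eq)
  moreover have "n \<notin> ascents n \<pi>" "finite (ascents n \<pi>)"
    by (auto simp: ascents_def)
  ultimately have "card (ascents (Suc n) \<pi>) =
      card (ascents n \<pi>) + of_bool (n > 0 \<and> \<pi> n < \<pi> (Suc n))"
    by auto
  with Suc show ?case
    by (simp add: list_ascents_append last_map)
qed

text \<open>Indexing by an arbitrary set of letters, not by a length, keeps the two pieces of a
  split word within the scope of the definition. That only the cardinality matters follows later, in
  \<open>signed_ascent_sum_eq\<close>.\<close>

definition signed_ascent_sum :: "nat set \<Rightarrow> int" where
  "signed_ascent_sum A = (\<Sum>xs\<in>permutations_of_set A. (-1) ^ list_ascents xs)"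

lemma signed_ascent_sum_empty [simp]: "signed_ascent_sum {} = 1"
  by (simp add: signed_ascent_sum_def)

lemma bij_betw_permutes_permutations_of_set:
  "bij_betw (\<lambda>\<pi>. map \<pi> [1..<Suc n]) {\<pi>. \<pi> permutes {1..n}} (permutations_of_set {1..n})"
proof -
  let ?P = "{\<pi>. \<pi> permutes {1..n}}" and ?g = "\<lambda>\<pi>. map \<pi> [1..<Suc n]"
  have inj: "inj_on ?g ?P"
  proof (rule inj_onI)
    fix \<pi> \<sigma> assume *: "\<pi> \<in> ?P" "\<sigma> \<in> ?P" "?g \<pi> = ?g \<sigma>"
    have "\<pi> i = \<sigma> i" if "i \<in> {1..n}" for i
      using *(3) that
      by (simp add: map_eq_conv atLeastLessThanSuc_atLeastAtMost del: upt_Suc)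
    moreover have "\<pi> i = \<sigma> i" if "i \<notin> {1..n}" for i
      using * that by (simp add: permutes_not_in del: upt_Suc)
    ultimately show "\<pi> = \<sigma>" by blast
  qed
  have "set (?g \<pi>) = {1..n}" if "\<pi> \<in> ?P" for \<pi>
    using that permutes_image[of \<pi> "{1..n}"]
    by (simp add: atLeastLessThanSuc_atLeastAtMost del: upt_Suc)
  moreover have "distinct (?g \<pi>)" if "\<pi> \<in> ?P" for \<pi>
    using that permutes_inj_on[of \<pi> "{1..n}"] by (simp add: distinct_map permutes_inj_on del: upt_Suc)
  ultimately have sub: "?g ` ?P \<subseteq> permutations_of_set {1..n}"
    by (auto simp: permutations_of_set_def simp del: upt_Suc)
  \<comment> \<open>Surjectivity comes from counting: both sides have n! elements.\<close>
  have "card (?g ` ?P) = card (permutations_of_set {1..n})"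
    using inj by (simp add: card_image card_permutations[OF refl])
  with sub have "?g ` ?P = permutations_of_set {1..n}"
    by (intro card_subset_eq) auto
  with inj show ?thesis by (simp add: bij_betw_def)
qed

lemma sum_sign_ascents:
  "(\<Sum>\<pi> | \<pi> permutes {1..n}. (-1) ^ card (ascents n \<pi>)) = signed_ascent_sum {1..n}"
  unfolding signed_ascent_sum_def
  by (subst sum.reindex_bij_betw[OF bij_betw_permutes_permutations_of_set, symmetric])
     (simp only: list_ascents_map)

section \<open>Splitting a word at its largest letter\<close>

lemma bij_betw_permutations_of_set_insert:
  assumes "m \<notin> A"
  shows "bij_betw (\<lambda>(B, xs, ys). xs @ m # ys)
    (SIGMA B:Pow A. permutations_of_set B \<times> permutations_of_set (A - B))
    (permutations_of_set (insert m A))"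
proof (rule bij_betwI[where g = "\<lambda>zs. let xs = takeWhile (\<lambda>z. z \<noteq> m) zs in
    (set xs, xs, tl (dropWhile (\<lambda>z. z \<noteq> m) zs))"], goal_cases)
  case 1
  then show ?case using assms by (auto simp: permutations_of_set_def)
next
  case 2
  show ?case
  proof
    fix zs assume zs: "zs \<in> permutations_of_set (insert m A)"
    then have "m \<in> set zs" by (auto simp: permutations_of_set_def)
    then obtain xs ys where "zs = xs @ m # ys" "m \<notin> set xs"
      by (meson split_list_first)
    then show "(let xs = takeWhile (\<lambda>z. z \<noteq> m) zs in
      (set xs, xs, tl (dropWhile (\<lambda>z. z \<noteq> m) zs))) \<in>
      (SIGMA B:Pow A. permutations_of_set B \<times> permutations_of_set (A - B))"
      using zs assms by (auto simp: permutations_of_set_def takeWhile_append dropWhile_append)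
  qed
next
  case (3 x)
  then obtain B xs ys where "x = (B, xs, ys)" "set xs = B" "m \<notin> set xs"
    using assms by (auto simp: permutations_of_set_def)
  then show ?case by (simp add: takeWhile_append dropWhile_append)
next
  case (4 zs)
  then have "m \<in> set zs" by (auto simp: permutations_of_set_def)
  then obtain xs ys where "zs = xs @ m # ys" "m \<notin> set xs"
    by (meson split_list_first)
  then show ?case by (simp add: takeWhile_append dropWhile_append)
qed

text \<open>In \<open>xs @ m # ys\<close> the letter \<open>m\<close> creates an ascent on its left
  exactly when \<open>xs\<close> is nonempty, and never one on its right. So each split contributes
  the product of the signs of \<open>xs\<close> and \<open>ys\<close>, negated unless
  \<open>xs\<close> is empty.\<close>

lemma signed_ascent_sum_insert_max:
  assumes "finite A" "\<And>x. x \<in> A \<Longrightarrow> x < m"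
  shows "signed_ascent_sum (insert m A) =
    2 * signed_ascent_sum A - (\<Sum>B\<in>Pow A. signed_ascent_sum B * signed_ascent_sum (A - B))"
proof -
  let ?f = signed_ascent_sum and ?P = permutations_of_set
  have "m \<notin> A" using assms(2) by blast
  have sign: "(-1) ^ list_ascents (xs @ m # ys) =
      (if B = {} then 1 else -1) * ((-1) ^ list_ascents xs * (-1) ^ list_ascents ys :: int)"
    if "B \<in> Pow A" "xs \<in> ?P B" "ys \<in> ?P (A - B)" for B xs ys
  proof -
    have "set xs = B" "set ys \<subseteq> A"
      using that by (auto simp: permutations_of_set_def)
    moreover have "last xs < m" if "xs \<noteq> []"
      using that \<open>set xs = B\<close> \<open>B \<in> Pow A\<close> last_in_set[OF that] assms(2) by blast
    moreover have "list_ascents (m # ys) = list_ascents ys"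
      using \<open>set ys \<subseteq> A\<close> assms(2) by (cases ys) (auto dest: less_asym)
    ultimately show ?thesis
      by (auto simp: list_ascents_append power_add)
  qed
  have "?f (insert m A) =
      (\<Sum>(B, xs, ys)\<in>(SIGMA B:Pow A. ?P B \<times> ?P (A - B)). (-1) ^ list_ascents (xs @ m # ys))"
    unfolding signed_ascent_sum_def
    by (subst sum.reindex_bij_betw[OF bij_betw_permutations_of_set_insert[OF \<open>m \<notin> A\<close>], symmetric])
       (simp add: case_prod_unfold)
  also have "\<dots> = (\<Sum>B\<in>Pow A. \<Sum>(xs, ys)\<in>?P B \<times> ?P (A - B). (-1) ^ list_ascents (xs @ m # ys))"
    using assms(1) by (subst sum.Sigma) (auto simp: case_prod_unfold)
  also have "\<dots> = (\<Sum>B\<in>Pow A. (if B = {} then 1 else -1) * (?f B * ?f (A - B)))"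
  proof (intro sum.cong refl)
    fix B assume "B \<in> Pow A"
    from sign[OF this] have "(\<Sum>(xs, ys)\<in>?P B \<times> ?P (A - B). (-1) ^ list_ascents (xs @ m # ys)) =
        (\<Sum>(xs, ys)\<in>?P B \<times> ?P (A - B).
          (if B = {} then 1 else -1) * ((-1) ^ list_ascents xs * (-1) ^ list_ascents ys :: int))"
      by (intro sum.cong refl) (simp add: case_prod_unfold mem_Times_iff)
    also have "\<dots> = (if B = {} then 1 else -1) * (?f B * ?f (A - B))"
      unfolding signed_ascent_sum_def sum_product sum.cartesian_product
      by (simp only: sum_distrib_left case_prod_unfold)
    finally show "(\<Sum>(xs, ys)\<in>?P B \<times> ?P (A - B). (-1) ^ list_ascents (xs @ m # ys)) =
        (if B = {} then 1 else -1) * (?f B * ?f (A - B))" .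
  qed
  \<comment> \<open>The sign is 2 - 1 for empty \<open>B\<close> and 0 - 1 otherwise; this isolates
    the full convolution.\<close>
  also have "\<dots> = (\<Sum>B\<in>Pow A. (if B = {} then 2 * ?f A else 0) - ?f B * ?f (A - B))"
    by (intro sum.cong) auto
  also have "\<dots> = 2 * ?f A - (\<Sum>B\<in>Pow A. ?f B * ?f (A - B))"
    using assms(1) by (simp add: sum_subtractf sum.delta)
  finally show ?thesis .
qed

lemma sum_Pow_card:
  fixes g :: "nat \<Rightarrow> 'a::comm_semiring_1"
  assumes "finite A"
  shows "(\<Sum>B\<in>Pow A. g (card B)) = (\<Sum>k\<le>card A. of_nat (card A choose k) * g k)"
proof -
  have "(\<Sum>B\<in>Pow A. g (card B)) = (\<Sum>k\<le>card A. \<Sum>B | B \<in> Pow A \<and> card B = k. g (card B))"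
    using assms by (intro sum.group[symmetric]) (auto intro: card_mono)
  also have "\<dots> = (\<Sum>k\<le>card A. of_nat (card A choose k) * g k)"
    using n_subsets[OF assms] by (intro sum.cong) auto
  finally show ?thesis .
qed

section \<open>The exponential generating function, which is 1 + tanh t\<close>

definition ascent_egf :: "real fps" where
  "ascent_egf = fps_const 2 / (1 + fps_exp (-2))"

lemma ascent_egf_mult: "ascent_egf * (1 + fps_exp (-2)) = fps_const 2"
  unfolding ascent_egf_def by (simp add: fps_divide_unit mult.assoc inverse_mult_eq_1)

lemma ascent_egf_deriv: "fps_deriv ascent_egf = fps_const 2 * ascent_egf - ascent_egf ^ 2"
proof -
  let ?G = "1 + fps_exp (-2) :: real fps"
  have "fps_deriv (ascent_egf * ?G) = 0" by (simp add: ascent_egf_mult)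
  then have "fps_deriv ascent_egf * ?G = fps_const 2 * ascent_egf * (?G - 1)"
    by (simp add: algebra_simps flip: fps_const_neg)
  \<comment> \<open>In the subtracted term the constant 2 is traded for
    \<open>ascent_egf * ?G\<close>, so that \<open>?G\<close> becomes a common factor to
    cancel.\<close>
  also have "\<dots> = fps_const 2 * ascent_egf * ?G - ascent_egf * (ascent_egf * ?G)"
    unfolding ascent_egf_mult by (simp add: algebra_simps)
  also have "\<dots> = (fps_const 2 * ascent_egf - ascent_egf ^ 2) * ?G"
    by (simp add: algebra_simps power2_eq_square)
  finally have "fps_deriv ascent_egf * ?G = (fps_const 2 * ascent_egf - ascent_egf ^ 2) * ?G" .
  moreover have "?G \<noteq> 0"
  proof
    assume "?G = 0"
    then have "fps_nth ?G 0 = 0" by (simp only: fps_zero_nth)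
    then show False by simp
  qed
  ultimately show ?thesis by (simp only: mult_cancel_right) blast
qed

text \<open>Products of exponential generating functions are binomial convolutions of their
  coefficient sequences.\<close>

lemma fps_mult_nth_fact:
  fixes F G :: "'a::field_char_0 fps"
  shows "fact n * fps_nth (F * G) n =
    (\<Sum>k\<le>n. of_nat (n choose k) * (fact k * fps_nth F k) * (fact (n - k) * fps_nth G (n - k)))"
  unfolding fps_mult_nth sum_distrib_left atMost_atLeast0
  by (intro sum.cong refl) (simp add: binomial_fact field_simps)

text \<open>Strong induction on the cardinality: removing \<open>Max A\<close> gives the recurrence
  of \<open>signed_ascent_sum_insert_max\<close>, which is the differential equation
  \<open>ascent_egf_deriv\<close> read off coefficientwise.\<close>

lemma signed_ascent_sum_eq:
  assumes "finite A"
  shows "of_int (signed_ascent_sum A) = fact (card A) * fps_nth ascent_egf (card A)"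
  using assms
proof (induction "card A" arbitrary: A rule: less_induct)
  case less
  let ?a = "\<lambda>n. fact n * fps_nth ascent_egf n"
  show ?case
  proof (cases "A = {}")
    case True
    \<comment> \<open>Since \<open>1 + fps_exp (-2)\<close> has constant term 2,
      \<open>ascent_egf\<close> has constant term 1, the value for the empty word.\<close>
    have "fps_nth (ascent_egf * (1 + fps_exp (-2))) 0 = 2"
      unfolding ascent_egf_mult by simp
    with True show ?thesis by simp
  next
    case False
    define C n where "C = A - {Max A}" and "n = card C"
    have C: "A = insert (Max A) C" "finite C" "\<And>x. x \<in> C \<Longrightarrow> x < Max A"
      using less.prems False Max_ge[of A] Max_in[of A]
      by (auto simp: C_def order.strict_iff_order simp del: Max_in)
    have card: "card A = Suc n"
      using card_Suc_Diff1[OF less.prems Max_in[OF less.prems False]]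
      unfolding C_def n_def by (rule sym)
    have IH: "of_int (signed_ascent_sum B) = ?a (card B)" if "B \<subseteq> C" for B
      using that C(2) card
      by (intro less.hyps) (auto simp: n_def less_Suc_eq_le card_mono intro: finite_subset)
    have "of_int (signed_ascent_sum A) =
        2 * ?a n - (\<Sum>B\<in>Pow C. ?a (card B) * ?a (n - card B))"
      using C(2) by (subst C(1), subst signed_ascent_sum_insert_max[OF C(2,3)])
        (auto simp: IH n_def card_Diff_subset finite_subset intro!: sum.cong)
    also have "\<dots> = 2 * ?a n - fact n * fps_nth (ascent_egf ^ 2) n"
      unfolding power2_eq_square fps_mult_nth_fact n_def
      by (subst sum_Pow_card[OF C(2), of "\<lambda>k. ?a k * ?a (card C - k)"]) (simp add: mult.assoc)
    also have "\<dots> = fact n * fps_nth (fps_deriv ascent_egf) n"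
      unfolding ascent_egf_deriv by (simp add: algebra_simps)
    also have "\<dots> = ?a (card A)" by (simp add: card)
    finally show ?thesis .
  qed
qed

section \<open>Reduction of the signed count modulo p\<close>

lemma alternating_sum_fps_exp:
  fixes c :: "'a::field_char_0"
  assumes "odd p"
  shows "(1 + fps_exp c) * (\<Sum>j<p. (-1) ^ j * fps_exp (of_nat j * c)) = 1 + fps_exp (of_nat p * c)"
  using one_diff_power_eq[of "- fps_exp c" p] assms
  by (simp add: power_minus[of "fps_exp c"] fps_exp_power_mult)

text \<open>Multiplying \<open>ascent_egf * (1 + fps_exp (-2)) = fps_const 2\<close> by the
  alternating geometric sum with ratio \<open>- fps_exp (-2)\<close> replaces -2 by -2p on the left;
  the claim compares the n-th coefficients times n!.\<close>

lemma signed_ascent_sum_convolution: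
  fixes p :: nat
  defines "a \<equiv> \<lambda>n. signed_ascent_sum {1..n}"
  assumes "odd p"
  shows "a n + (\<Sum>k\<le>n. int (n choose k) * a k * (- 2 * int p) ^ (n - k)) =
    2 * (\<Sum>j<p. (-1) ^ j * (- 2 * int j) ^ n)"
proof -
  let ?S = "\<Sum>j<p. (-1) ^ j * fps_exp (of_nat j * (-2)) :: real fps"
  have a: "fact k * fps_nth ascent_egf k = of_int (a k)" for k
    using signed_ascent_sum_eq[of "{1..k}"] by (simp add: a_def)
  have exp: "fact k * fps_nth (fps_exp c) k = c ^ k" for k and c :: real
    by simp
  have S: "fact n * fps_nth ?S n = (\<Sum>j<p. (-1) ^ j * (- 2 * real j) ^ n)"
  proof -
    have "(-1) ^ j = fps_const ((-1) ^ j :: real)" for j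
      by (simp flip: fps_const_power fps_const_neg)
    then show ?thesis
      by (simp add: fps_sum_nth sum_distrib_left mult.commute)
  qed
  have "ascent_egf * (1 + fps_exp (of_nat p * (-2))) = fps_const 2 * ?S"
    unfolding alternating_sum_fps_exp[OF \<open>odd p\<close>, symmetric] mult.assoc[symmetric] ascent_egf_mult ..
  then have "fact n * fps_nth (ascent_egf + ascent_egf * fps_exp (of_nat p * (-2))) n =
      2 * (fact n * fps_nth ?S n)"
    by (simp add: distrib_left)
  then have "of_int (a n) + (\<Sum>k\<le>n. real (n choose k) * of_int (a k) * (of_nat p * (-2)) ^ (n - k)) =
      2 * (\<Sum>j<p. (-1) ^ j * (- 2 * real j) ^ n)"
    unfolding S fps_add_nth distrib_left fps_mult_nth_fact a exp .
  then have "real_of_int (a n + (\<Sum>k\<le>n. int (n choose k) * a k * (- 2 * int p) ^ (n - k))) =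
      real_of_int (2 * (\<Sum>j<p. (-1) ^ j * (- 2 * int j) ^ n))"
    by (simp add: mult.commute)
  then show ?thesis by (simp only: of_int_eq_iff)
qed

lemma signed_ascent_sum_cong:
  assumes "odd p"
  shows "[2 * signed_ascent_sum {1..n} = 2 * (\<Sum>j<p. (-1) ^ j * (- 2 * int j) ^ n)] (mod int p)"
proof -
  let ?a = "\<lambda>k. signed_ascent_sum {1..k}"
  \<comment> \<open>For \<open>k < n\<close> the exponent \<open>n - k\<close> is positive, so a
    factor p is present; the remaining term \<open>k = n\<close> is a second copy of
    \<open>?a n\<close>, whence the factor 2 in the claim.\<close>
  have "int p dvd (\<Sum>k<n. int (n choose k) * ?a k * (- 2 * int p) ^ (n - k))"
    by (intro dvd_sum dvd_mult dvd_power_le[of _ _ 1, simplified]) auto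
  moreover have "(\<Sum>k\<le>n. int (n choose k) * ?a k * (- 2 * int p) ^ (n - k)) =
      (\<Sum>k<n. int (n choose k) * ?a k * (- 2 * int p) ^ (n - k)) + ?a n"
    by (simp flip: lessThan_Suc_atMost)
  ultimately show ?thesis
    unfolding signed_ascent_sum_convolution[OF assms, symmetric]
    by (simp add: cong_iff_dvd_diff dvd_diff_commute)
qed

section \<open>The Fermat quotient of 2 as an alternating power sum\<close>

text \<open>By Pascal's rule neighbouring entries of row \<open>p - 1\<close> add up to an entry of
  row \<open>p\<close> that is divisible by p, so the sign flips at each step.\<close>

lemma choose_pred_prime_cong:
  assumes "prime p" "k < p"
  shows "[int (p - 1 choose k) = (-1) ^ k] (mod int p)"
  using assms(2)
proof (induction k)
  case (Suc k)
  have "int p dvd int (p choose Suc k)"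
    using assms(1) Suc.prems by (intro of_nat_dvd_iff[THEN iffD2] dvd_choose_prime) auto
  moreover have "p choose Suc k = (p - 1 choose k) + (p - 1 choose Suc k)"
    using prime_gt_0_nat[OF assms(1)] by (metis Suc_pred' binomial_Suc_Suc)
  ultimately have "[int (p - 1 choose k) + int (p - 1 choose Suc k) = 0] (mod int p)"
    by (simp add: cong_0_iff)
  from cong_diff[OF this Suc.IH] Suc.prems show ?case by simp
qed simp

lemma fermat_theorem_int:
  assumes "prime p" "0 < m" "m < p"
  shows "[int m ^ (p - 1) = 1] (mod int p)"
proof -
  have "\<not> p dvd m" using assms(2,3) by (auto dest: dvd_imp_le)
  from fermat_theorem[OF assms(1) this] show ?thesis
    by (metis cong_int_iff of_nat_1 of_nat_power)
qed

text \<open>Dividing the interior binomials of row \<open>p\<close> by p gives integers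
  \<open>c m\<close> with sum (2^p - 2)/p, twice the Fermat quotient. Absorption gives m *
  \<open>c m\<close> = binomial(p-1, m-1), congruent to (-1)^(m-1), and m^(p-2) inverts m modulo
  p.\<close>

lemma fermat_quotient_2_cong:
  assumes "prime p" "odd p"
  shows "[2 * int (fermat_quotient p 2) = (\<Sum>m=1..<p. (-1) ^ (m - 1) * int m ^ (p - 2))] (mod int p)"
proof -
  have "p > 2" using assms prime_gt_1_nat[of p] by (cases "p = 2") auto
  define c where "c m = (p choose m) div p" for m
  have c: "p choose m = p * c m" if "m \<in> {1..<p}" for m
    using that assms(1) by (simp add: c_def dvd_choose_prime)
  have "[int (c m) = (-1) ^ (m - 1) * int m ^ (p - 2)] (mod int p)" if m: "m \<in> {1..<p}" for m
  proof -
    have "m * (p choose m) = p * (p - 1 choose (m - 1))"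
      using m by (intro times_binomial_minus1_eq) auto
    then have "p * (m * c m) = p * (p - 1 choose (m - 1))"
      using c[OF m] by (simp add: ac_simps)
    then have mc: "int m * int (c m) = int (p - 1 choose (m - 1))"
      using \<open>p > 2\<close> by (simp flip: of_nat_mult)
    have "int m ^ (p - 1) * int (c m) = int m ^ (p - 2) * (int m * int (c m))"
      using \<open>p > 2\<close> by (simp add: numeral_2_eq_2 Suc_diff_Suc flip: power_Suc2)
    also have "[\<dots> = int m ^ (p - 2) * (-1) ^ (m - 1)] (mod int p)"
      unfolding mc using m by (intro cong_scalar_left choose_pred_prime_cong assms(1)) auto
    finally have "[int m ^ (p - 1) * int (c m) = (-1) ^ (m - 1) * int m ^ (p - 2)] (mod int p)"
      by (simp only: mult.commute)
    moreover have "[int m ^ (p - 1) * int (c m) = 1 * int (c m)] (mod int p)"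
      using m by (intro cong_scalar_right fermat_theorem_int assms(1)) auto
    ultimately show ?thesis
      by (metis cong_sym cong_trans mult_1)
  qed
  then have "[(\<Sum>m=1..<p. int (c m)) = (\<Sum>m=1..<p. (-1) ^ (m - 1) * int m ^ (p - 2))] (mod int p)"
    by (rule cong_sum)
  moreover have "2 * fermat_quotient p 2 = (\<Sum>m=1..<p. c m)"
  proof -
    have "\<not> p dvd 2" using \<open>p > 2\<close> by (auto dest: dvd_imp_le)
    then have "p * fermat_quotient p 2 = 2 ^ (p - 1) - 1"
      by (rule fermat_quotient_exact[OF assms(1)])
    then have "p * (2 * fermat_quotient p 2) = 2 * 2 ^ (p - 1) - 2"
      by simp
    also have "\<dots> = 2 ^ p - 2"
      using \<open>p > 2\<close> by (simp flip: power_Suc)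
    also have "2 ^ p = (\<Sum>m\<le>p. p choose m)"
      by (rule choose_row_sum[symmetric])
    \<comment> \<open>The two end terms of the row are both 1 and cancel the 2.\<close>
    also have "{..p} = insert 0 (insert p {1..<p})"
      using \<open>p > 2\<close> by auto
    also have "(\<Sum>m\<in>\<dots>. p choose m) - 2 = (\<Sum>m=1..<p. p choose m)"
      using \<open>p > 2\<close> by simp
    also have "\<dots> = p * (\<Sum>m=1..<p. c m)"
      by (simp add: c sum_distrib_left)
    finally show ?thesis using \<open>p > 2\<close> by simp
  qed
  then have "2 * int (fermat_quotient p 2) = (\<Sum>m=1..<p. int (c m))"
    by (metis of_nat_mult of_nat_numeral of_nat_sum)
  ultimately show ?thesis by (simp only:)
qed

lemma signed_ascent_sum_fermat_quotient:
  assumes "prime p" "odd p"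
  shows "[signed_ascent_sum {1..p - 2} = int (fermat_quotient p 2)] (mod int p)"
proof -
  have "p > 2" using assms prime_gt_1_nat[of p] by (cases "p = 2") auto
  have "odd (p - 2)" using assms(2) \<open>p > 2\<close> by simp
  have two: "2 * 2 ^ (p - 2) = (2 ^ (p - 1) :: int)"
    using \<open>p > 2\<close> by (simp add: numeral_2_eq_2 Suc_diff_Suc flip: power_Suc)
  \<comment> \<open>The term \<open>j = 0\<close> vanishes because the exponent \<open>p - 2\<close>
    is positive.\<close>
  have "2 * (\<Sum>j<p. (-1) ^ j * (- 2 * int j) ^ (p - 2)) =
      2 * (\<Sum>m=1..<p. (-1) ^ m * (- 2 * int m) ^ (p - 2))"
    using \<open>p > 2\<close> by (simp add: lessThan_atLeast0 sum.atLeast_Suc_lessThan)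
  also have "\<dots> = 2 ^ (p - 1) * (\<Sum>m=1..<p. (-1) ^ (m - 1) * int m ^ (p - 2))"
    unfolding sum_distrib_left two[symmetric]
  proof (intro sum.cong refl)
    fix m assume "m \<in> {1..<p}"
    \<comment> \<open>This sign cancels the one that the odd power of \<open>- 2 * int m\<close>
      produces.\<close>
    then have "(-1) ^ m = - ((-1) ^ (m - 1) :: int)" by (cases m) auto
    with \<open>odd (p - 2)\<close> show "2 * ((-1) ^ m * (- 2 * int m) ^ (p - 2)) =
        2 * 2 ^ (p - 2) * ((-1) ^ (m - 1) * int m ^ (p - 2))"
      by (simp add: power_mult_distrib)
  qed
  also have "[\<dots> = 1 * (2 * int (fermat_quotient p 2))] (mod int p)"
    using fermat_theorem_int[OF assms(1), of 2] \<open>p > 2\<close>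
    by (intro cong_mult cong_sym[OF fermat_quotient_2_cong] assms) simp
  finally have "[2 * signed_ascent_sum {1..p - 2} = 2 * int (fermat_quotient p 2)] (mod int p)"
    using cong_trans[OF signed_ascent_sum_cong[OF assms(2)]] by (simp only: mult_1)
  moreover have "coprime 2 (int p)" using assms(2) by simp
  ultimately show ?thesis by (simp add: cong_mult_lcancel)
qed

section \<open>From the signed count to the even-ascent count\<close>

text \<open>The weight 1 + (-1)^asc is 2 on permutations with an even number of ascents and 0 on the
  others. The added 1 restores the identity, whose \<open>n - 1\<close> ascents are even in number
  as \<open>n\<close> is odd.\<close>

lemma two_even_ascent_count:
  assumes "odd n"
  shows "2 * (int (even_ascent_count n) + 1) = fact n + signed_ascent_sum {1..n}"
proof -
  let ?P = "{\<pi>. \<pi> permutes {1..n}}" and ?asc = "\<lambda>\<pi>. card (ascents n \<pi>)"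
  define E where "E = {\<pi> \<in> ?P. even (?asc \<pi>)}"
  have fin: "finite ?P" by (simp add: finite_permutations)
  have "ascents n id = {1..<n}" by (auto simp: ascents_def)
  with assms have "id \<in> E" by (simp add: E_def)
  have "even_ascent_count n = card (E - {id})"
    unfolding even_ascent_count_def E_def by (intro arg_cong[where f = card]) auto
  also have "\<dots> + 1 = card E"
    using card_Suc_Diff1[OF _ \<open>id \<in> E\<close>] fin by (simp add: E_def)
  finally have "2 * (int (even_ascent_count n) + 1) = 2 * int (card E)" by simp
  also have "\<dots> = (\<Sum>\<pi>\<in>E. 2)" by simp
  also have "\<dots> = (\<Sum>\<pi>\<in>?P. 1 + (-1) ^ ?asc \<pi>)"
    unfolding E_def using fin by (intro sum.mono_neutral_cong_left) auto
  also have "\<dots> = fact n + signed_ascent_sum {1..n}"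
    unfolding sum.distrib sum_sign_ascents by (simp add: card_permutations[OF refl])
  finally show ?thesis .
qed

theorem theorem1:
  fixes p :: nat
  assumes "prime p" and "odd p"
  shows "[fermat_quotient p 2 = 2 * even_ascent_count (p - 2) + 1] (mod p)"
proof -
  have "p > 2" using assms prime_gt_1_nat[of p] by (cases "p = 2") auto
  \<comment> \<open>Wilson's theorem gives -1 for (p-1)!, and the factor \<open>p - 1\<close> is
    itself -1 modulo p, which leaves 1 for (p-2)!.\<close>
  have "fact (p - 1) = int (p - 1) * fact (p - 2)"
    using \<open>p > 2\<close> fact_reduce[of "p - 1", where 'a = int] by (simp add: numeral_2_eq_2)
  with wilson_theorem[OF assms(1)] have "[- 1 = int (p - 1) * fact (p - 2)] (mod int p)"
    by (simp add: cong_sym)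
  also have "int (p - 1) * fact (p - 2) = int p * fact (p - 2) - fact (p - 2)"
    using \<open>p > 2\<close> by (simp add: of_nat_diff algebra_simps)
  also have "[\<dots> = - fact (p - 2)] (mod int p)"
    by (simp add: cong_iff_dvd_diff)
  finally have fact: "[fact (p - 2) = 1] (mod int p)"
    using cong_minus_minus_iff cong_sym by blast
  have "2 * int (even_ascent_count (p - 2)) + 1 =
      fact (p - 2) + signed_ascent_sum {1..p - 2} - 1"
    using two_even_ascent_count[of "p - 2"] assms(2) \<open>p > 2\<close> by simp
  also have "[\<dots> = 1 + int (fermat_quotient p 2) - 1] (mod int p)"
    by (intro cong_diff cong_add fact signed_ascent_sum_fermat_quotient assms cong_refl)
  finally have "[int (2 * even_ascent_count (p - 2) + 1) = int (fermat_quotient p 2)] (mod int p)"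
    by (simp add: add.commute)
  then show ?thesis
    unfolding cong_int_iff by (rule cong_sym)
qed

end
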